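(* Let $b_{ij,k}$ ($i,j,k\in\{1,2,3\}$) be real numbers such that the formula $$V(\mathbf f)_k=\sum_{i,j=1}^3 b_{ij,k}f_if_j,\qquad k=1,2,3,$$ defines a map $V:S\to S$. Put $$\alpha_k=\sqrt{\sum_{j=1}^3\Big(\sum_{i=1}^3|b_{ij,k}|\Big)^2}+\sqrt{\sum_{i=1}^3\Big(\sum_{j=1}^3|b_{ij,k}|\Big)^2},\qquad \alpha=\sum_{k=1}^3\alpha_k^2 .$$ If $\alpha<1$, then $V$ is a contraction, hence $(0,0,0)$ is a unique stable fixed point of $V$.
   Context: $S=\{\mathbf p\in\mathbb{R}^3: p_1^2+p_2^2+p_3^2\le 1\}$ is the closed Euclidean unit ball, with the Euclidean metric. "$(0,0,0)$ is a unique stable fixed point" means that it is the only fixed point of $V$ in $S$ and that $V^n(\mathbf f)\to(0,0,0)$ as $n\to\infty$ for every $\mathbf f\in S$, where $V^n$ is the $n$-th iterate. *)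

theory Defs
  imports "HOL-Analysis.Analysis"
begin

(* The coefficient b_{ij,k} is written b i j k; the index type 3 has exactly three elements. *)

definition quad_op :: "(3 \<Rightarrow> 3 \<Rightarrow> 3 \<Rightarrow> real) \<Rightarrow> real ^ 3 \<Rightarrow> real ^ 3" where
  "quad_op b f = (\<chi> k. \<Sum>i\<in>UNIV. \<Sum>j\<in>UNIV. b i j k * f $ i * f $ j)"

definition alpha_comp :: "(3 \<Rightarrow> 3 \<Rightarrow> 3 \<Rightarrow> real) \<Rightarrow> 3 \<Rightarrow> real" where
  "alpha_comp b k =
     sqrt (\<Sum>j\<in>UNIV. (\<Sum>i\<in>UNIV. \<bar>b i j k\<bar>)\<^sup>2) +
     sqrt (\<Sum>i\<in>UNIV. (\<Sum>j\<in>UNIV. \<bar>b i j k\<bar>)\<^sup>2)"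

definition alpha :: "(3 \<Rightarrow> 3 \<Rightarrow> 3 \<Rightarrow> real) \<Rightarrow> real" where
  "alpha b = (\<Sum>k\<in>UNIV. (alpha_comp b k)\<^sup>2)"

(* A contraction in the sense of Banach: one Lipschitz constant L < 1 works for all pairs of
   points of S.  The condition 0 \<le> L is part of lipschitz_on. *)

definition contraction_on :: "'a::metric_space set \<Rightarrow> ('a \<Rightarrow> 'a) \<Rightarrow> bool" where
  "contraction_on S V \<longleftrightarrow> (\<exists>L<1. L-lipschitz_on S V)"

definition unique_stable_fixed_point ::
    "'a::topological_space set \<Rightarrow> ('a \<Rightarrow> 'a) \<Rightarrow> 'a \<Rightarrow> bool" where
  "unique_stable_fixed_point S V p \<longleftrightarrow>
     {f \<in> S. V f = f} = {p} \<and> (\<forall>f\<in>S. (\<lambda>n. (V ^^ n) f) \<longlonglongrightarrow> p)"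

end

theory Submission
  imports Defs
begin

text \<open>Writing \<open>f\<^sub>i f\<^sub>j - g\<^sub>i g\<^sub>j = f\<^sub>i (f\<^sub>j - g\<^sub>j) + (f\<^sub>i - g\<^sub>i) g\<^sub>j\<close> and bounding the factors \<open>f\<^sub>i\<close>, \<open>g\<^sub>j\<close> by 1,
  the Cauchy--Schwarz inequality applied to each of the two sums gives
  \<open>\<bar>V(f)\<^sub>k - V(g)\<^sub>k\<bar> \<le> \<alpha>\<^sub>k \<parallel>f - g\<parallel>\<close>. Hence \<open>V\<close> is Lipschitz on the ball with constant \<open>sqrt \<alpha>\<close>.\<close>

lemma abs_bilinear_le:
  fixes c :: "'m::finite \<Rightarrow> 'n::finite \<Rightarrow> real" and x :: "real ^ 'm" and y :: "real ^ 'n"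
  assumes "norm x \<le> 1"
  shows "\<bar>\<Sum>i\<in>UNIV. \<Sum>j\<in>UNIV. c i j * x $ i * y $ j\<bar>
    \<le> sqrt (\<Sum>j\<in>UNIV. (\<Sum>i\<in>UNIV. \<bar>c i j\<bar>)\<^sup>2) * norm y"
proof -
  have x: "\<bar>x $ i\<bar> \<le> 1" for i
    using component_le_norm_cart[of x i] assms by linarith
  have "\<bar>\<Sum>i\<in>UNIV. \<Sum>j\<in>UNIV. c i j * x $ i * y $ j\<bar>
      \<le> (\<Sum>i\<in>UNIV. \<Sum>j\<in>UNIV. \<bar>c i j\<bar> * \<bar>y $ j\<bar>)"
  proof (intro order_trans[OF sum_abs] sum_mono)
    fix i j
    have "\<bar>c i j\<bar> * \<bar>x $ i\<bar> * \<bar>y $ j\<bar> \<le> \<bar>c i j\<bar> * 1 * \<bar>y $ j\<bar>"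
      by (intro mult_right_mono mult_left_mono x) auto
    then show "\<bar>c i j * x $ i * y $ j\<bar> \<le> \<bar>c i j\<bar> * \<bar>y $ j\<bar>"
      by (simp only: abs_mult mult_1_right)
  qed
  \<comment> \<open>Summing over \<open>i\<close> first collects the coefficients of each component
    of \<open>y\<close>. The outer absolute value, around a nonnegative sum, matches the form of
    Cauchy-Schwarz in \<open>L2_set_mult_ineq\<close>.\<close>
  also have "\<dots> = (\<Sum>j\<in>UNIV. \<bar>\<Sum>i\<in>UNIV. \<bar>c i j\<bar>\<bar> * \<bar>y $ j\<bar>)"
    by (subst sum.swap) (simp add: sum_distrib_right sum_nonneg)
  also have "\<dots> \<le> sqrt (\<Sum>j\<in>UNIV. (\<Sum>i\<in>UNIV. \<bar>c i j\<bar>)\<^sup>2) * norm y"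
    using L2_set_mult_ineq[of "\<lambda>j. \<Sum>i\<in>UNIV. \<bar>c i j\<bar>" "\<lambda>j. y $ j" UNIV]
    by (simp add: norm_vec_def L2_set_def)
  finally show ?thesis .
qed

lemma alpha_nonneg: "0 \<le> alpha b"
  by (simp add: alpha_def sum_nonneg)

lemma quad_op_component_diff_le:
  assumes "norm f \<le> 1" "norm g \<le> 1"
  shows "\<bar>quad_op b f $ k - quad_op b g $ k\<bar> \<le> alpha_comp b k * norm (f - g)"
proof -
  \<comment> \<open>The second sum has its indices interchanged, so that \<open>f - g\<close> is the
    second argument in both. Applied to the transposed coefficients, \<open>abs_bilinear_le\<close>
    then yields the second root in \<open>alpha_comp\<close>.\<close>
  have "quad_op b f $ k - quad_op b g $ k =
      (\<Sum>i\<in>UNIV. \<Sum>j\<in>UNIV. b i j k * f $ i * (f - g) $ j)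
    + (\<Sum>i\<in>UNIV. \<Sum>j\<in>UNIV. b j i k * g $ i * (f - g) $ j)"
    by (subst (2) sum.swap)
      (simp add: quad_op_def algebra_simps flip: sum.distrib sum_subtractf)
  also have "\<bar>\<dots>\<bar> \<le> alpha_comp b k * norm (f - g)"
    using abs_bilinear_le[OF assms(1), of "\<lambda>i j. b i j k" "f - g"]
      abs_bilinear_le[OF assms(2), of "\<lambda>i j. b j i k" "f - g"]
    unfolding alpha_comp_def distrib_right by linarith
  finally show ?thesis .
qed

lemma lipschitz_on_quad_op: "(sqrt (alpha b))-lipschitz_on (cball 0 1) (quad_op b)"
proof (rule lipschitz_onI)
  fix f g :: "real ^ 3"
  assume "f \<in> cball 0 1" "g \<in> cball 0 1"
  then have "norm f \<le> 1" "norm g \<le> 1" by simp_all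
  then have "norm (quad_op b f - quad_op b g)
      \<le> L2_set (\<lambda>k. alpha_comp b k * norm (f - g)) UNIV"
    by (subst (1) norm_vec_def, intro L2_set_mono) (simp_all add: quad_op_component_diff_le)
  \<comment> \<open>The factor \<open>norm (f - g)\<close> is common to all \<open>k\<close>; what
    remains is the Euclidean norm of the vector of the \<open>alpha_comp b k\<close>.\<close>
  also have "\<dots> = sqrt (alpha b) * norm (f - g)"
    by (simp add: L2_set_def alpha_def power_mult_distrib real_sqrt_mult flip: sum_distrib_right)
  finally show "dist (quad_op b f) (quad_op b g) \<le> sqrt (alpha b) * dist f g"
    by (simp add: dist_norm)
qed (simp add: alpha_nonneg)

text \<open>Since \<open>p\<close> is known to be fixed, each application of \<open>V\<close>
  shrinks the distance to \<open>p\<close> by the factor \<open>L\<close>, and geometric decay gives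
  convergence.\<close>

lemma contraction_unique_stable_fixed_point:
  assumes contr: "contraction_on S V" and maps: "V \<in> S \<rightarrow> S" and p: "p \<in> S" "V p = p"
  shows "unique_stable_fixed_point S V p"
proof -
  obtain L where L: "L < 1" "L-lipschitz_on S V"
    using contr unfolding contraction_on_def by blast
  have L0: "0 \<le> L" using L(2) by (rule lipschitz_on_nonneg)
  \<comment> \<open>Membership in \<open>S\<close> is carried through the induction because the
    Lipschitz bound holds only there.\<close>
  have iter: "(V ^^ n) f \<in> S \<and> dist ((V ^^ n) f) p \<le> L ^ n * dist f p" if "f \<in> S" for f n
  proof (induction n)
    case (Suc n)
    have "dist (V ((V ^^ n) f)) p \<le> L * dist ((V ^^ n) f) p"
      using lipschitz_onD[OF L(2), of "(V ^^ n) f" p] Suc.IH p by simp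
    also have "\<dots> \<le> L * (L ^ n * dist f p)"
      using Suc.IH L0 by (intro mult_left_mono) auto
    finally show ?case using Suc.IH maps by (auto simp: mult.assoc)
  qed (use that in simp)
  have lim: "(\<lambda>n. (V ^^ n) f) \<longlonglongrightarrow> p" if "f \<in> S" for f
  proof (rule metric_tendsto_imp_tendsto)
    show "(\<lambda>n. L ^ n * dist f p) \<longlonglongrightarrow> 0"
      using L(1) L0 by (intro tendsto_mult_left_zero LIMSEQ_realpow_zero)
    show "\<forall>\<^sub>F n in sequentially. dist ((V ^^ n) f) p \<le> dist (L ^ n * dist f p) 0"
      using iter[OF that] L0 by (simp add: abs_mult)
  qed
  \<comment> \<open>The orbit of a fixed point is constant, yet it converges to
    \<open>p\<close>.\<close>
  have "f = p" if "f \<in> S" "V f = f" for f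
  proof -
    have "(V ^^ n) f = f" for n by (induction n) (use that in auto)
    then show ?thesis using lim[OF that(1)] by (simp add: tendsto_const_iff)
  qed
  with p lim show ?thesis unfolding unique_stable_fixed_point_def by blast
qed

theorem theorem4p4:
  fixes b :: "3 \<Rightarrow> 3 \<Rightarrow> 3 \<Rightarrow> real"
  assumes "quad_op b \<in> cball 0 1 \<rightarrow> cball 0 1"
    and "alpha b < 1"
  shows "contraction_on (cball 0 1) (quad_op b) \<and>
         unique_stable_fixed_point (cball 0 1) (quad_op b) 0"
proof -
  have contr: "contraction_on (cball 0 1) (quad_op b)"
    unfolding contraction_on_def
    using lipschitz_on_quad_op assms(2) real_sqrt_lt_1_iff by blast
  moreover have "quad_op b 0 = 0"
    by (simp add: quad_op_def vec_eq_iff)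
  ultimately show ?thesis
    using contraction_unique_stable_fixed_point[OF contr assms(1)] by simp
qed

end
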